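(* If $\Gamma \vdash \mathbb{M}:\tau$ and $\mathbb{M} \longrightarrow \mathbb{M}'$ then $\Gamma \vdash \mathbb{M}' :\tau$.
   Context: $\widehat{\lambda}_{\oplus}$ is the fragment of the sharing calculus $\widehat{\lambda}^{\text{↯}}_{\oplus}$ without $\mathtt{fail}$: terms $M ::= x \mid \lambda x.(M[\widetilde{x}\leftarrow x]) \mid M\,B \mid M\langle\!\langle N/x\rangle\!\rangle \mid M[\widetilde{x}\leftarrow x] \mid (M[\widetilde{x}\leftarrow x])\langle B/x\rangle$, bags (multisets), expressions = sums. Reduction rules: $(\lambda x.M[\widetilde{x}\leftarrow x])B\longrightarrow M[\widetilde{x}\leftarrow x]\langle B/x\rangle$; $M[x_1,\dots,x_k\leftarrow x]\langle B/x\rangle\longrightarrow\sum_{B_i\in\mathrm{PER}(B)}M\langle\!\langle B_i(1)/x_1\rangle\!\rangle\cdots\langle\!\langle B_i(k)/x_k\rangle\!\rangle$ ($|B|=k\ge1$); $M\langle\!\langle N/x\rangle\!\rangle\longrightarrow M\{\!|N/x|\!\}$ if $\mathrm{head}(M)=x$ (linear head substitution); closure under term and sum contexts. $\vdash$ is the non-idempotent intersection type system (strict types $\sigma::=\mathbf{unit}\mid\pi\to\sigma$, multiset types $\bigwedge_i\sigma_i\mid\omega$) with sharing rule $\Delta,x_1{:}\sigma,\dots,x_k{:}\sigma\vdash M:\tau \Rightarrow \Delta,x{:}\sigma^k\vdash M[x_1,\dots,x_k\leftarrow x]:\tau$ ($k\ne0$), weakening $M[\leftarrow x]$ with $x:\omega$,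 abstraction over a shared variable, application and explicit substitution requiring exact match of bag type $\sigma^k$, explicit linear substitution consuming one $x:\sigma$, and a sum rule. *)

theory Defs
  imports Main "HOL-Library.Multiset" "HOL-Combinatorics.Multiset_Permutations"
    "HOL-Combinatorics.Transposition"
begin

section \<open>Terms, bags and expressions\<close>

text \<open>
  Abstractions and explicit substitutions carry their sharing construct, as the grammar demands:
  \<^item> \<open>Abs x xs M\<close> is \<open>\<lambda>x.(M[xs \<leftarrow> x])\<close>;
  \<^item> \<open>LSub M N x\<close> is the explicit linear substitution \<open>M\<langle>\<langle>N/x\<rangle>\<rangle>\<close>;
  \<^item> \<open>Share M xs x\<close> is \<open>M[xs \<leftarrow> x]\<close>, which binds \<open>xs\<close> in \<open>M\<close> and leaves \<open>x\<close> free;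
  \<^item> \<open>ESub M xs x B\<close> is \<open>(M[xs \<leftarrow> x])\<langle>B/x\<rangle>\<close>.

  Bags are finite multisets of terms. The linearity conditions on variables (every shared or
  linearly substituted variable occurs exactly once in its scope, not as a sharing variable) are
  consequences of typability. Variables are a type parameter only so that the datatype package
  provides renaming (\<open>map_tm\<close>).
\<close>

datatype 'v tm =
    Var 'v
  | Abs 'v "'v list" "'v tm"
  | App "'v tm" "'v tm multiset"
  | LSub "'v tm" "'v tm" 'v
  | Share "'v tm" "'v list" 'v
  | ESub "'v tm" "'v list" 'v "'v tm multiset"

type_synonym var = nat
type_synonym tmv = "var tm"
type_synonym bag = "tmv multiset"

text \<open>
  A sum of terms is the multiset of its summands, i.e. \<open>+\<close> is associative and commutative.
  The empty multiset is not an expression; it has no type.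
\<close>

type_synonym expr = "tmv multiset"

primrec fv :: "'v tm \<Rightarrow> 'v set" where
  "fv (Var x) = {x}"
| "fv (Abs x xs M) = fv M - set xs - {x}"
| "fv (App M B) = fv M \<union> \<Union> (set_mset (image_mset fv B))"
| "fv (LSub M N x) = (fv M - {x}) \<union> fv N"
| "fv (Share M xs x) = insert x (fv M - set xs)"
| "fv (ESub M xs x B) = (fv M - set xs - {x}) \<union> \<Union> (set_mset (image_mset fv B))"

section \<open>Alpha-equivalence\<close>

abbreviation swap :: "var \<Rightarrow> var \<Rightarrow> tmv \<Rightarrow> tmv" where
  "swap a b \<equiv> map_tm (transpose a b)"

text \<open>
  The least congruence that identifies an abstracted scope with its image under any transposition
  of two names that are not free in that scope. \<open>Abs\<close> and \<open>ESub\<close> contain two nested scopes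
  (of the shared variables and of the sharing variable), hence two renaming rules each.
\<close>

inductive alpha :: "tmv \<Rightarrow> tmv \<Rightarrow> bool" (infix \<open>=\<^sub>\<alpha>\<close> 50) where
  refl: "M =\<^sub>\<alpha> M"
| sym: "M =\<^sub>\<alpha> N \<Longrightarrow> N =\<^sub>\<alpha> M"
| trans: "M =\<^sub>\<alpha> N \<Longrightarrow> N =\<^sub>\<alpha> L \<Longrightarrow> M =\<^sub>\<alpha> L"
| Abs: "M =\<^sub>\<alpha> M' \<Longrightarrow> Abs x xs M =\<^sub>\<alpha> Abs x xs M'"
| App: "M =\<^sub>\<alpha> M' \<Longrightarrow> App M B =\<^sub>\<alpha> App M' B"
| App_bag: "N =\<^sub>\<alpha> N' \<Longrightarrow> App M (add_mset N B) =\<^sub>\<alpha> App M (add_mset N' B)"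
| LSub1: "M =\<^sub>\<alpha> M' \<Longrightarrow> LSub M N x =\<^sub>\<alpha> LSub M' N x"
| LSub2: "N =\<^sub>\<alpha> N' \<Longrightarrow> LSub M N x =\<^sub>\<alpha> LSub M N' x"
| Share: "M =\<^sub>\<alpha> M' \<Longrightarrow> Share M xs x =\<^sub>\<alpha> Share M' xs x"
| ESub: "M =\<^sub>\<alpha> M' \<Longrightarrow> ESub M xs x B =\<^sub>\<alpha> ESub M' xs x B"
| ESub_bag: "N =\<^sub>\<alpha> N' \<Longrightarrow> ESub M xs x (add_mset N B) =\<^sub>\<alpha> ESub M xs x (add_mset N' B)"
| rename_LSub: "{a, b} \<inter> (fv M - {x}) = {} \<Longrightarrow>
    LSub M N x =\<^sub>\<alpha> LSub (swap a b M) N (transpose a b x)"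
| rename_Share: "{a, b} \<inter> (fv M - set xs) = {} \<Longrightarrow>
    Share M xs x =\<^sub>\<alpha> Share (swap a b M) (map (transpose a b) xs) x"
| rename_Abs_shared: "{a, b} \<inter> (fv M - set xs) = {} \<Longrightarrow>
    Abs x xs M =\<^sub>\<alpha> Abs x (map (transpose a b) xs) (swap a b M)"
| rename_Abs: "{a, b} \<inter> (fv (Share M xs x) - {x}) = {} \<Longrightarrow>
    Abs x xs M =\<^sub>\<alpha> Abs (transpose a b x) (map (transpose a b) xs) (swap a b M)"
| rename_ESub_shared: "{a, b} \<inter> (fv M - set xs) = {} \<Longrightarrow>
    ESub M xs x B =\<^sub>\<alpha> ESub (swap a b M) (map (transpose a b) xs) x B"
| rename_ESub: "{a, b} \<inter> (fv (Share M xs x) - {x}) = {} \<Longrightarrow>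
    ESub M xs x B =\<^sub>\<alpha> ESub (swap a b M) (map (transpose a b) xs) (transpose a b x) B"

section \<open>Reduction\<close>

text \<open>In \<open>head_shared xs x H\<close>, \<open>H\<close> is the head of the \<open>M\<close> in \<open>M[xs \<leftarrow> x]\<close>.\<close>

fun head_shared :: "var list \<Rightarrow> var \<Rightarrow> tmv \<Rightarrow> tmv" where
  "head_shared xs x (Var y) = (if y \<in> set xs then Var x else Var y)"
| "head_shared xs x H = H"

fun head :: "tmv \<Rightarrow> tmv" where
  "head (Var x) = Var x"
| "head (Abs x xs M) = Abs x xs M"
| "head (App M B) = head M"
| "head (LSub M N x) = head M"
| "head (Share M xs x) = head_shared xs x (head M)"
| "head (ESub M xs x B) = head_shared xs x (head M)"

text \<open>
  \<open>lhsubst N x M M'\<close> says that \<open>M'\<close> is \<open>M{|N/x|}\<close>. Linear head substitution is capture-avoiding: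
  it is undefined if a binder on the path to the head is \<open>x\<close> or is free in \<open>N\<close>, and reduction
  is closed under alpha-equivalence so that such binders can be renamed. It is also undefined
  if \<open>x\<close> is a sharing variable.
\<close>

inductive lhsubst :: "tmv \<Rightarrow> var \<Rightarrow> tmv \<Rightarrow> tmv \<Rightarrow> bool" for N :: tmv and x :: var where
  Var: "lhsubst N x (Var x) N"
| App: "lhsubst N x M M' \<Longrightarrow> lhsubst N x (App M B) (App M' B)"
| LSub: "lhsubst N x M M' \<Longrightarrow> y \<noteq> x \<Longrightarrow> y \<notin> fv N \<Longrightarrow>
    lhsubst N x (LSub M L y) (LSub M' L y)"
| Share: "lhsubst N x M M' \<Longrightarrow> y \<noteq> x \<Longrightarrow> set ys \<inter> insert x (fv N) = {} \<Longrightarrow>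
    lhsubst N x (Share M ys y) (Share M' ys y)"
| ESub: "lhsubst N x M M' \<Longrightarrow> y \<noteq> x \<Longrightarrow> y \<notin> fv N \<Longrightarrow> set ys \<inter> insert x (fv N) = {} \<Longrightarrow>
    lhsubst N x (ESub M ys y B) (ESub M' ys y B)"

text \<open>\<open>lsubs M [N1, ..., Nk] [x1, ..., xk]\<close> is \<open>M\<langle>\<langle>N1/x1\<rangle>\<rangle>...\<langle>\<langle>Nk/xk\<rangle>\<rangle>\<close>.\<close>

definition lsubs :: "tmv \<Rightarrow> tmv list \<Rightarrow> var list \<Rightarrow> tmv" where
  "lsubs M Ns xs = foldl (\<lambda>L (N, x). LSub L N x) M (zip Ns xs)"

text \<open>
  In \<open>Ex_Sub\<close>, \<open>PER(B)\<close> is the set of distinct orderings of \<open>B\<close>. The premise on \<open>fv\<close> prevents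
  \<open>xj\<close> from capturing variables of an \<open>Ni\<close> with \<open>i < j\<close>. The premise on alpha-equivalence picks
  a representative of \<open>B\<close> in which alpha-equivalent members are equal, so that counting
  orderings of \<open>B\<close> means counting them up to alpha. By rule \<open>alpha\<close>, neither
  premise restricts the reductions of the alpha-equivalence class.
\<close>

inductive red :: "expr \<Rightarrow> expr \<Rightarrow> bool" (infix \<open>\<leadsto>\<close> 50) where
  Beta: "{#App (Abs x xs M) B#} \<leadsto> {#ESub M xs x B#}"
| Ex_Sub: "size B = length xs \<Longrightarrow> length xs \<ge> 1 \<Longrightarrow>
    (\<forall>N \<in># B. set xs \<inter> fv N = {}) \<Longrightarrow>
    (\<forall>N \<in># B. \<forall>N' \<in># B. N =\<^sub>\<alpha> N' \<longrightarrow> N = N') \<Longrightarrow>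
    {#ESub M xs x B#} \<leadsto> {#lsubs M Ns xs. Ns \<in># mset_set (permutations_of_multiset B)#}"
| Lin_Fetch: "head M = Var x \<Longrightarrow> lhsubst N x M M' \<Longrightarrow> {#LSub M N x#} \<leadsto> {#M'#}"
| TCont_App: "{#M#} \<leadsto> E \<Longrightarrow> {#App M B#} \<leadsto> {#App M' B. M' \<in># E#}"
| TCont_LSub: "{#M#} \<leadsto> E \<Longrightarrow> {#LSub M N x#} \<leadsto> {#LSub M' N x. M' \<in># E#}"
| TCont_Share: "{#M#} \<leadsto> E \<Longrightarrow> {#Share M xs x#} \<leadsto> {#Share M' xs x. M' \<in># E#}"
| TCont_ESub: "{#M#} \<leadsto> E \<Longrightarrow> {#ESub M xs x B#} \<leadsto> {#ESub M' xs x B. M' \<in># E#}"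
| ECont: "E \<leadsto> E' \<Longrightarrow> E + F \<leadsto> E' + F"
| alpha: "rel_mset (=\<^sub>\<alpha>) E E1 \<Longrightarrow> E1 \<leadsto> E2 \<Longrightarrow> rel_mset (=\<^sub>\<alpha>) E2 E' \<Longrightarrow> E \<leadsto> E'"

section \<open>Non-idempotent intersection types\<close>

text \<open>
  Multiset types are finite multisets of strict types: \<open>\<omega>\<close> is \<open>{#}\<close>, and \<open>\<sigma>^k\<close> is
  \<open>replicate_mset k \<sigma>\<close>. A context assigns to each of its variables either a strict type (linear
  variables) or a multiset type (sharing variables); \<open>\<Gamma>, \<Delta>\<close> is \<open>\<Gamma> ++ \<Delta>\<close> for disjoint domains.
\<close>

datatype sty = Unit | Arr "sty multiset" sty

datatype asg = Strict sty | Multi "sty multiset"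

type_synonym ctx = "var \<rightharpoonup> asg"

inductive ty_tm :: "ctx \<Rightarrow> tmv \<Rightarrow> sty \<Rightarrow> bool" (\<open>_ \<turnstile>\<^sub>t _ \<Colon> _\<close> [50, 50, 50] 50)
  and ty_bag :: "ctx \<Rightarrow> bag \<Rightarrow> sty multiset \<Rightarrow> bool" (\<open>_ \<turnstile>\<^sub>b _ \<Colon> _\<close> [50, 50, 50] 50)
where
  var: "[x \<mapsto> Strict \<sigma>] \<turnstile>\<^sub>t Var x \<Colon> \<sigma>"
| one: "Map.empty \<turnstile>\<^sub>b {#} \<Colon> {#}"
| bag: "\<Gamma> \<turnstile>\<^sub>t M \<Colon> \<sigma> \<Longrightarrow> \<Delta> \<turnstile>\<^sub>b B \<Colon> replicate_mset k \<sigma> \<Longrightarrow> dom \<Gamma> \<inter> dom \<Delta> = {} \<Longrightarrow>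
    \<Gamma> ++ \<Delta> \<turnstile>\<^sub>b add_mset M B \<Colon> replicate_mset (Suc k) \<sigma>"
| abs_sh: "\<Delta>(x \<mapsto> Multi (replicate_mset k \<sigma>)) \<turnstile>\<^sub>t Share M xs x \<Colon> \<tau> \<Longrightarrow> x \<notin> dom \<Delta> \<Longrightarrow>
    \<Delta> \<turnstile>\<^sub>t Abs x xs M \<Colon> Arr (replicate_mset k \<sigma>) \<tau>"
| weak: "\<Gamma> \<turnstile>\<^sub>t M \<Colon> \<tau> \<Longrightarrow> x \<notin> dom \<Gamma> \<Longrightarrow> \<Gamma>(x \<mapsto> Multi {#}) \<turnstile>\<^sub>t Share M [] x \<Colon> \<tau>"
| share: "\<Delta>(xs [\<mapsto>] replicate k (Strict \<sigma>)) \<turnstile>\<^sub>t M \<Colon> \<tau> \<Longrightarrow> length xs = k \<Longrightarrow> k \<noteq> 0 \<Longrightarrow>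
    distinct xs \<Longrightarrow> set xs \<inter> dom \<Delta> = {} \<Longrightarrow> x \<notin> dom \<Delta> \<Longrightarrow>
    \<Delta>(x \<mapsto> Multi (replicate_mset k \<sigma>)) \<turnstile>\<^sub>t Share M xs x \<Colon> \<tau>"
| app: "\<Gamma> \<turnstile>\<^sub>t M \<Colon> Arr \<pi> \<tau> \<Longrightarrow> \<Delta> \<turnstile>\<^sub>b B \<Colon> \<pi> \<Longrightarrow> dom \<Gamma> \<inter> dom \<Delta> = {} \<Longrightarrow>
    \<Gamma> ++ \<Delta> \<turnstile>\<^sub>t App M B \<Colon> \<tau>"
| ex_lin_sub: "\<Delta> \<turnstile>\<^sub>t N \<Colon> \<sigma> \<Longrightarrow> \<Gamma>(x \<mapsto> Strict \<sigma>) \<turnstile>\<^sub>t M \<Colon> \<tau> \<Longrightarrow> x \<notin> dom \<Gamma> \<Longrightarrow>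
    dom \<Gamma> \<inter> dom \<Delta> = {} \<Longrightarrow> \<Gamma> ++ \<Delta> \<turnstile>\<^sub>t LSub M N x \<Colon> \<tau>"
| ex_sub: "\<Delta> \<turnstile>\<^sub>b B \<Colon> replicate_mset k \<sigma> \<Longrightarrow>
    \<Gamma>(x \<mapsto> Multi (replicate_mset k \<sigma>)) \<turnstile>\<^sub>t Share M xs x \<Colon> \<tau> \<Longrightarrow> x \<notin> dom \<Gamma> \<Longrightarrow>
    dom \<Gamma> \<inter> dom \<Delta> = {} \<Longrightarrow> \<Gamma> ++ \<Delta> \<turnstile>\<^sub>t ESub M xs x B \<Colon> \<tau>"

inductive ty_expr :: "ctx \<Rightarrow> expr \<Rightarrow> sty \<Rightarrow> bool" (\<open>_ \<turnstile> _ \<Colon> _\<close> [50, 50, 50] 50) where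
  tm: "\<Gamma> \<turnstile>\<^sub>t M \<Colon> \<tau> \<Longrightarrow> \<Gamma> \<turnstile> {#M#} \<Colon> \<tau>"
| sum: "\<Gamma> \<turnstile> E \<Colon> \<tau> \<Longrightarrow> \<Gamma> \<turnstile> F \<Colon> \<tau> \<Longrightarrow> \<Gamma> \<turnstile> E + F \<Colon> \<tau>"

end

theory Submission imports Defs begin

text \<open>
  A typing context has exactly the free variables of its term as domain. Hence names that are
  fresh for a scope do not occur in its context, so equivariance of typing gives invariance under
  alpha-equivalence. For linear head substitution the head variable occurs on the path
  to the head only, so the context of the substituted term can be spliced in along that path.
\<close>

section \<open>Contexts\<close>

text \<open>All shared names receive the same assignment, so the order of the updates is irrelevant
  and equalities of such contexts reduce to a pointwise case split.\<close>

lemma map_upds_replicate: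
  "m(xs [\<mapsto>] replicate (length xs) v) = (\<lambda>y. if y \<in> set xs then Some v else m y)"
  by (induction xs arbitrary: m) (auto simp: fun_eq_iff)

lemma dom_comp_transpose: "dom (\<Gamma> \<circ> transpose a b) = transpose a b ` dom \<Gamma>"
  by (force simp: image_iff)

lemma disjoint_dom_comp_transpose:
  "dom \<Gamma> \<inter> dom \<Delta> = {} \<Longrightarrow> dom (\<Gamma> \<circ> transpose a b) \<inter> dom (\<Delta> \<circ> transpose a b) = {}"
  unfolding dom_comp_transpose by (simp flip: image_Int add: inj_transpose)

lemma map_add_comp: "(\<Gamma> ++ \<Delta>) \<circ> p = (\<Gamma> \<circ> p) ++ (\<Delta> \<circ> p)"
  by (simp add: fun_eq_iff map_add_def split: option.split)

lemma map_upd_comp_transpose: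
  "\<Gamma>(x \<mapsto> v) \<circ> transpose a b = (\<Gamma> \<circ> transpose a b)(transpose a b x \<mapsto> v)"
  by (auto simp: fun_eq_iff)

lemma map_upds_comp_transpose:
  "\<Gamma>(xs [\<mapsto>] replicate (length xs) v) \<circ> transpose a b =
    (\<Gamma> \<circ> transpose a b)(map (transpose a b) xs [\<mapsto>] replicate (length xs) v)"
  using map_upds_replicate[of "\<Gamma> \<circ> transpose a b" "map (transpose a b) xs" v]
  by (auto simp: fun_eq_iff map_upds_replicate image_iff)

text \<open>For substitution under an application or an explicit substitution:
  \<open>\<Gamma>1\<close> types the side of the head, where \<open>x\<close> is replaced, and
  \<open>\<Gamma>2\<close> types the argument, which stays as it is.\<close>

lemma map_add_remove_swap:
  assumes "dom \<Delta> \<inter> dom \<Gamma>2 = {}" "\<Gamma>2 x = None"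
  shows "(\<Gamma>1 ++ \<Gamma>2)(x := None) ++ \<Delta> = (\<Gamma>1(x := None) ++ \<Delta>) ++ \<Gamma>2"
proof
  fix y
  from assms(1) have "\<Gamma>2 y = None \<or> \<Delta> y = None" by (auto simp: domIff disjoint_iff)
  with assms(2) show "((\<Gamma>1 ++ \<Gamma>2)(x := None) ++ \<Delta>) y = ((\<Gamma>1(x := None) ++ \<Delta>) ++ \<Gamma>2) y"
    by (auto simp: map_add_def split: option.split)
qed

text \<open>The transposition only exchanges two names at which the context is undefined. This is
  why renaming a scope leaves its context alone.\<close>

lemma fresh_comp_transpose: "{a, b} \<inter> dom \<Gamma> = {} \<Longrightarrow> \<Gamma> \<circ> transpose a b = \<Gamma>"
  by (auto simp: fun_eq_iff transpose_def domIff)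

section \<open>Generation lemmas for typing\<close>

text \<open>Axioms have minimal contexts, disjoint contexts are joined, and \<open>weak\<close> adds
  a variable that is free in the new term; hence no assumption is idle.\<close>

lemma dom_eq_fv:
  "\<Gamma> \<turnstile>\<^sub>t M \<Colon> \<tau> \<Longrightarrow> dom \<Gamma> = fv M"
  "\<Gamma> \<turnstile>\<^sub>b B \<Colon> \<pi> \<Longrightarrow> dom \<Gamma> = \<Union> (fv ` set_mset B)"
proof (induction rule: ty_tm_ty_bag.inducts)
  case (share \<Delta> xs k \<sigma> M \<tau> x)
  from share have "dom \<Delta> \<union> set xs = fv M" by auto
  with share show ?case by auto
next
  case (abs_sh \<Delta> x k \<sigma> M xs \<tau>)
  \<comment> \<open>The induction hypothesis concerns the whole sharing term, in which
    \<open>x\<close> is free; \<open>x\<close> is then cancelled on both sides.\<close>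
  from abs_sh have "insert x (dom \<Delta>) = insert x (fv M - set xs)" "x \<notin> dom \<Delta>"
    by (simp_all del: fun_upd_apply)
  then show ?case by auto
next
  case (ex_sub \<Delta> B k \<sigma> \<Gamma> x M xs \<tau>)
  from ex_sub have "insert x (dom \<Gamma>) = insert x (fv M - set xs)" "x \<notin> dom \<Gamma>"
    by (simp_all del: fun_upd_apply)
  then have "dom \<Gamma> = fv M - set xs - {x}" by auto
  with ex_sub show ?case by auto
next
  case (ex_lin_sub \<Delta> N \<sigma> \<Gamma> x M \<tau>)
  from ex_lin_sub have "insert x (dom \<Gamma>) = fv M" "x \<notin> dom \<Gamma>"
    by (simp_all del: fun_upd_apply)
  then have "dom \<Gamma> = fv M - {x}" by auto
  with ex_lin_sub show ?case by auto
qed (auto simp del: fun_upd_apply)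

lemma ty_Var_iff: "\<Gamma> \<turnstile>\<^sub>t Var x \<Colon> \<tau> \<longleftrightarrow> \<Gamma> = [x \<mapsto> Strict \<tau>]"
  by (auto intro: var elim: ty_tm.cases)

text \<open>This and the following generation lemmas are equivalences, so that they can rewrite both
  sides of a typing equivalence in \<open>alpha_ty\<close>.\<close>

lemma ty_App_iff:
  "\<Theta> \<turnstile>\<^sub>t App M B \<Colon> \<tau> \<longleftrightarrow>
    (\<exists>\<Gamma> \<Delta> \<pi>. \<Theta> = \<Gamma> ++ \<Delta> \<and> dom \<Gamma> \<inter> dom \<Delta> = {} \<and> \<Gamma> \<turnstile>\<^sub>t M \<Colon> Arr \<pi> \<tau> \<and> \<Delta> \<turnstile>\<^sub>b B \<Colon> \<pi>)"
  by (rule iffI, erule ty_tm.cases, simp_all) (blast intro: app)+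

lemma ty_LSub_iff:
  "\<Theta> \<turnstile>\<^sub>t LSub M N x \<Colon> \<tau> \<longleftrightarrow>
    (\<exists>\<Gamma> \<Delta> \<sigma>. \<Theta> = \<Gamma> ++ \<Delta> \<and> dom \<Gamma> \<inter> dom \<Delta> = {} \<and> x \<notin> dom \<Gamma> \<and>
      \<Gamma>(x \<mapsto> Strict \<sigma>) \<turnstile>\<^sub>t M \<Colon> \<tau> \<and> \<Delta> \<turnstile>\<^sub>t N \<Colon> \<sigma>)"
  by (rule iffI, erule ty_tm.cases, simp_all) (blast intro: ex_lin_sub)+

lemma ty_Abs_iff:
  "\<Delta> \<turnstile>\<^sub>t Abs x xs M \<Colon> \<rho> \<longleftrightarrow>
    (\<exists>k \<sigma> \<tau>. \<rho> = Arr (replicate_mset k \<sigma>) \<tau> \<and> x \<notin> dom \<Delta> \<and>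
      \<Delta>(x \<mapsto> Multi (replicate_mset k \<sigma>)) \<turnstile>\<^sub>t Share M xs x \<Colon> \<tau>)"
  by (rule iffI, erule ty_tm.cases, simp_all) (blast intro: abs_sh)+

lemma ty_ESub_iff:
  "\<Theta> \<turnstile>\<^sub>t ESub M xs x B \<Colon> \<tau> \<longleftrightarrow>
    (\<exists>\<Gamma> \<Delta> k \<sigma>. \<Theta> = \<Gamma> ++ \<Delta> \<and> dom \<Gamma> \<inter> dom \<Delta> = {} \<and> \<Delta> \<turnstile>\<^sub>b B \<Colon> replicate_mset k \<sigma> \<and>
      x \<notin> dom \<Gamma> \<and> \<Gamma>(x \<mapsto> Multi (replicate_mset k \<sigma>)) \<turnstile>\<^sub>t Share M xs x \<Colon> \<tau>)"
  by (rule iffI, erule ty_tm.cases, simp_all) (blast intro: ex_sub)+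

text \<open>Sharing and weakening are one rule: for \<open>xs = []\<close> the multiset type below is \<open>\<omega>\<close>.\<close>

lemma ty_Share_iff:
  "\<Theta> \<turnstile>\<^sub>t Share M xs x \<Colon> \<tau> \<longleftrightarrow>
    (\<exists>\<Delta> \<sigma>. \<Theta> = \<Delta>(x \<mapsto> Multi (replicate_mset (length xs) \<sigma>)) \<and> x \<notin> dom \<Delta> \<and>
      distinct xs \<and> set xs \<inter> dom \<Delta> = {} \<and>
      \<Delta>(xs [\<mapsto>] replicate (length xs) (Strict \<sigma>)) \<turnstile>\<^sub>t M \<Colon> \<tau>)" (is "?L \<longleftrightarrow> ?R")
proof
  assume ?L
  then show ?R
  proof (cases rule: ty_tm.cases)
    case (weak \<Gamma>)
    then show ?thesis by (intro exI[of _ \<Gamma>]) (simp del: fun_upd_apply)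
  next
    case (share \<Delta> k \<sigma>)
    then show ?thesis by (intro exI[of _ \<Delta>] exI[of _ \<sigma>]) (simp del: fun_upd_apply)
  qed
next
  assume ?R
  then obtain \<Delta> \<sigma> where *: "\<Theta> = \<Delta>(x \<mapsto> Multi (replicate_mset (length xs) \<sigma>))"
    "x \<notin> dom \<Delta>" "distinct xs" "set xs \<inter> dom \<Delta> = {}"
    "\<Delta>(xs [\<mapsto>] replicate (length xs) (Strict \<sigma>)) \<turnstile>\<^sub>t M \<Colon> \<tau>"
    by blast
  show ?L
  proof (cases "xs = []")
    case True
    with * weak[of \<Delta> M \<tau> x] show ?thesis by (simp del: fun_upd_apply)
  next
    case False
    with * share[of \<Delta> xs "length xs" \<sigma> M \<tau> x] show ?thesis by (simp del: fun_upd_apply)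
  qed
qed

text \<open>For contexts in which \<open>x\<close> is already split off, as in the premise of
  \<open>ex_sub\<close>: the decomposition found by \<open>ty_Share_iff\<close> must then be the
  given one.\<close>

lemma ty_Share_upd_iff:
  assumes "x \<notin> dom \<Delta>"
  shows "\<Delta>(x \<mapsto> Multi \<pi>) \<turnstile>\<^sub>t Share M xs x \<Colon> \<tau> \<longleftrightarrow>
    (\<exists>\<sigma>. \<pi> = replicate_mset (length xs) \<sigma> \<and> distinct xs \<and> set xs \<inter> dom \<Delta> = {} \<and>
      \<Delta>(xs [\<mapsto>] replicate (length xs) (Strict \<sigma>)) \<turnstile>\<^sub>t M \<Colon> \<tau>)"
proof -
  \<comment> \<open>Both residual contexts are undefined at \<open>x\<close> and agree elsewhere,
    and the two multiset types are the values at \<open>x\<close>.\<close>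
  have eq: "\<Delta>' = \<Delta>" "\<pi>' = \<pi>"
    if "\<Delta>(x \<mapsto> Multi \<pi>) = \<Delta>'(x \<mapsto> Multi \<pi>')" "x \<notin> dom \<Delta>'" for \<Delta>' \<pi>'
  proof -
    have "\<Delta>' y = \<Delta> y" for y
      using fun_cong[OF that(1), of y] that(2) assms by (cases "y = x") (auto simp: domIff)
    then show "\<Delta>' = \<Delta>" by blast
    show "\<pi>' = \<pi>" using fun_cong[OF that(1), of x] by simp
  qed
  show ?thesis
    unfolding ty_Share_iff using assms by (blast dest: eq)
qed

text \<open>A nonempty power determines exponent and base, whereas every power with exponent 0 is
  \<omega>; hence the successor.\<close>

lemma replicate_mset_eq_Suc:
  "replicate_mset k \<sigma> = replicate_mset (Suc n) \<rho> \<longleftrightarrow> k = Suc n \<and> \<sigma> = \<rho>"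
  by (metis in_replicate_mset nat.distinct(1) neq0_conv size_replicate_mset)

text \<open>The last rule of a derivation may split off any member of the bag. Disjoint contexts
  commute, so the derivation can be rearranged to split off \<open>M\<close> last.\<close>

lemma ty_bag_add_mset_iff:
  "\<Theta> \<turnstile>\<^sub>b add_mset M B \<Colon> \<pi> \<longleftrightarrow>
    (\<exists>\<Gamma> \<Delta> k \<sigma>. \<Theta> = \<Gamma> ++ \<Delta> \<and> dom \<Gamma> \<inter> dom \<Delta> = {} \<and> \<pi> = replicate_mset (Suc k) \<sigma> \<and>
      \<Gamma> \<turnstile>\<^sub>t M \<Colon> \<sigma> \<and> \<Delta> \<turnstile>\<^sub>b B \<Colon> replicate_mset k \<sigma>)" (is "?L \<longleftrightarrow> ?R \<Theta> B \<pi>")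
proof
  show "?R \<Theta> B \<pi> \<Longrightarrow> ?L" by (auto intro: bag simp del: replicate_mset_Suc)
  show "?L \<Longrightarrow> ?R \<Theta> B \<pi>"
  proof (induction B arbitrary: \<Theta> \<pi> rule: measure_induct_rule[of size])
    case (less B)
    from less.prems show ?case
    proof (cases rule: ty_bag.cases)
      case (bag \<Gamma> M' \<sigma> \<Delta> B' k)
      show ?thesis
      proof (cases "M = M' \<and> B = B'")
        case True
        with bag show ?thesis by blast
      next
        case False
        \<comment> \<open>\<open>C\<close> is the bag without both \<open>M\<close> and
          \<open>M'\<close>. The induction hypothesis extracts \<open>M\<close> from
          \<open>B'\<close>, and then \<open>M'\<close> is put back onto \<open>C\<close> to form
          \<open>B\<close>.\<close>
        with bag(2) obtain C where C: "B = add_mset M' C" "B' = add_mset M C"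
          by (auto simp: add_eq_conv_ex)
        from less.IH[of C \<Delta> "replicate_mset k \<sigma>"] bag C
        obtain \<Gamma>1 \<Delta>1 k1 where 1: "\<Delta> = \<Gamma>1 ++ \<Delta>1" "dom \<Gamma>1 \<inter> dom \<Delta>1 = {}" "k = Suc k1"
          "\<Gamma>1 \<turnstile>\<^sub>t M \<Colon> \<sigma>" "\<Delta>1 \<turnstile>\<^sub>b C \<Colon> replicate_mset k1 \<sigma>"
          by (auto simp: replicate_mset_eq_Suc simp del: replicate_mset_Suc)
        have "\<Gamma> ++ \<Gamma>1 = \<Gamma>1 ++ \<Gamma>" using 1(1) bag(6) by (intro map_add_comm) auto
        then have "\<Theta> = \<Gamma>1 ++ (\<Gamma> ++ \<Delta>1)" using 1(1) bag(1) by simp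
        moreover have "\<Gamma> ++ \<Delta>1 \<turnstile>\<^sub>b B \<Colon> replicate_mset k \<sigma>"
          unfolding C 1(3) using 1 bag(4,6) by (intro ty_tm_ty_bag.bag) auto
        moreover have "dom \<Gamma>1 \<inter> dom (\<Gamma> ++ \<Delta>1) = {}"
          using 1(1,2) bag(6) by auto
        ultimately show ?thesis using bag(3) 1(4) by blast
      qed
    qed auto
  qed
qed

section \<open>Invariance under alpha-equivalence\<close>

lemma swap_swap [simp]: "swap a b (swap a b M) = M"
  by (simp add: tm.map_comp tm.map_id)

lemma fv_swap: "fv (swap a b M) = transpose a b ` fv M"
proof (induction M)
  case (Abs x xs M)
  then show ?case by (simp add: image_set_diff inj_transpose)
next
  case (App M B)
  then show ?case by auto
next
  case (LSub M N x)
  then show ?case by (simp add: image_Un image_set_diff inj_transpose)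
next
  case (Share M xs x)
  then show ?case by (simp add: image_set_diff inj_transpose)
next
  case (ESub M xs x B)
  then show ?case by (simp add: image_Un image_UN image_set_diff inj_transpose)
qed simp

text \<open>A set that contains neither \<open>a\<close> nor \<open>b\<close> is fixed by the
  transposition. This makes the renaming lemmas applicable to the swapped term, which gives their
  converses.\<close>

lemma fresh_swap:
  assumes "{a, b} \<inter> (fv M - X) = {}"
  shows "{a, b} \<inter> (fv (swap a b M) - transpose a b ` X) = {}"
proof -
  have "fv (swap a b M) - transpose a b ` X = transpose a b ` (fv M - X)"
    by (simp add: fv_swap image_set_diff inj_transpose)
  then show ?thesis using assms by (auto simp: transpose_def)
qed

text \<open>A transposition is its own inverse, so precomposition with it renames a context. The
  side conditions are distinctness and disjointness, which injective renaming preserves.\<close>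

lemma ty_swap:
  "\<Gamma> \<turnstile>\<^sub>t M \<Colon> \<tau> \<Longrightarrow> \<Gamma> \<circ> transpose a b \<turnstile>\<^sub>t swap a b M \<Colon> \<tau>"
  "\<Gamma> \<turnstile>\<^sub>b B \<Colon> \<pi> \<Longrightarrow> \<Gamma> \<circ> transpose a b \<turnstile>\<^sub>b image_mset (swap a b) B \<Colon> \<pi>"
proof (induction rule: ty_tm_ty_bag.inducts)
  case (var x \<sigma>)
  have "[x \<mapsto> Strict \<sigma>] \<circ> transpose a b = [transpose a b x \<mapsto> Strict \<sigma>]"
    by (auto simp: fun_eq_iff)
  then show ?case unfolding tm.map by (simp only: ty_tm_ty_bag.var)
next
  case one
  have "Map.empty \<circ> transpose a b = Map.empty" by (simp add: fun_eq_iff)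
  then show ?case by (simp add: ty_tm_ty_bag.one)
next
  case (bag \<Gamma> M \<sigma> \<Delta> B k)
  then show ?case
    unfolding map_add_comp image_mset_add_mset
    by (intro ty_tm_ty_bag.bag disjoint_dom_comp_transpose)
next
  case (abs_sh \<Delta> x k \<sigma> M xs \<tau>)
  then show ?case
    unfolding map_upd_comp_transpose tm.map
    by (intro ty_tm_ty_bag.abs_sh) (assumption, auto)
next
  case (weak \<Gamma> M \<tau> x)
  then show ?case
    unfolding map_upd_comp_transpose tm.map list.map
    by (intro ty_tm_ty_bag.weak) (assumption, auto)
next
  case (share \<Delta> xs k \<sigma> M \<tau> x)
  have "distinct (map (transpose a b) xs)"
    using share.hyps by (simp add: distinct_map inj_transpose inj_on_subset)
  moreover have "set (map (transpose a b) xs) \<inter> dom (\<Delta> \<circ> transpose a b) = {}"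
    "transpose a b x \<notin> dom (\<Delta> \<circ> transpose a b)"
    using share.hyps by auto
  moreover have "(\<Delta> \<circ> transpose a b)(map (transpose a b) xs [\<mapsto>] replicate k (Strict \<sigma>))
      \<turnstile>\<^sub>t swap a b M \<Colon> \<tau>"
    using share.IH by (simp only: map_upds_comp_transpose flip: \<open>length xs = k\<close>)
  ultimately show ?case
    unfolding map_upd_comp_transpose tm.map using share.hyps
    by (intro ty_tm_ty_bag.share) (assumption | simp only: length_map)+
next
  case (app \<Gamma> M \<pi> \<tau> \<Delta> B)
  then show ?case
    unfolding map_add_comp tm.map
    by (intro ty_tm_ty_bag.app disjoint_dom_comp_transpose)
next
  case (ex_lin_sub \<Delta> N \<sigma> \<Gamma> x M \<tau>)
  then show ?case
    unfolding map_add_comp tm.map map_upd_comp_transpose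
    by (intro ty_tm_ty_bag.ex_lin_sub disjoint_dom_comp_transpose) (assumption+, auto)
next
  case (ex_sub \<Delta> B k \<sigma> \<Gamma> x M xs \<tau>)
  then show ?case
    unfolding map_add_comp tm.map map_upd_comp_transpose
    by (intro ty_tm_ty_bag.ex_sub disjoint_dom_comp_transpose) (assumption+, auto)
qed

text \<open>Equivariance is applied to the premise about \<open>M\<close> only. The sharing variable
  \<open>x\<close> is outside the renamed scope and may itself be \<open>a\<close> or
  \<open>b\<close>.\<close>

lemma ty_rename_Share:
  assumes "{a, b} \<inter> (fv M - set xs) = {}" "\<Gamma> \<turnstile>\<^sub>t Share M xs x \<Colon> \<tau>"
  shows "\<Gamma> \<turnstile>\<^sub>t Share (swap a b M) (map (transpose a b) xs) x \<Colon> \<tau>"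
proof -
  from assms(2) obtain \<Delta> \<sigma> where *: "\<Gamma> = \<Delta>(x \<mapsto> Multi (replicate_mset (length xs) \<sigma>))"
    "x \<notin> dom \<Delta>" "distinct xs" "set xs \<inter> dom \<Delta> = {}"
    and M: "\<Delta>(xs [\<mapsto>] replicate (length xs) (Strict \<sigma>)) \<turnstile>\<^sub>t M \<Colon> \<tau>"
    unfolding ty_Share_iff by blast
  have "dom \<Delta> \<subseteq> fv M - set xs" using dom_eq_fv(1)[OF M] *(4) by auto
  then have \<Delta>: "\<Delta> \<circ> transpose a b = \<Delta>" using assms(1) by (intro fresh_comp_transpose) blast
  have "transpose a b ` set xs \<inter> dom (\<Delta> \<circ> transpose a b) = {}"
    using *(4) by auto
  with ty_swap(1)[OF M, of a b] * show ?thesis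
    unfolding ty_Share_iff map_upds_comp_transpose \<Delta>
    by (intro exI[of _ \<Delta>] exI[of _ \<sigma>]) (simp add: distinct_map inj_transpose inj_on_subset)
qed

text \<open>For abstractions and explicit substitutions, where \<open>x\<close> is bound as well and
  is renamed along with the sharing term. The first conjunct is the side condition of
  \<open>abs_sh\<close> and \<open>ex_sub\<close> for the new name.\<close>

lemma ty_rename_Share_bound:
  assumes "{a, b} \<inter> (fv (Share M xs x) - {x}) = {}" "x \<notin> dom \<Gamma>"
    and "\<Gamma>(x \<mapsto> v) \<turnstile>\<^sub>t Share M xs x \<Colon> \<tau>"
  shows "transpose a b x \<notin> dom \<Gamma> \<and>
    \<Gamma>(transpose a b x \<mapsto> v)
      \<turnstile>\<^sub>t Share (swap a b M) (map (transpose a b) xs) (transpose a b x) \<Colon> \<tau>"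
proof -
  have "dom \<Gamma> = fv (Share M xs x) - {x}" using dom_eq_fv(1)[OF assms(3)] assms(2) by auto
  then have \<Gamma>: "\<Gamma> \<circ> transpose a b = \<Gamma>" using assms(1) by (intro fresh_comp_transpose) simp
  \<comment> \<open>A context fixed by the swap is undefined at the image of \<open>x\<close>
    because it is undefined at \<open>x\<close>.\<close>
  then have "\<Gamma> (transpose a b x) = \<Gamma> x" by (metis comp_apply)
  with assms(2) ty_swap(1)[OF assms(3), of a b] show ?thesis
    by (simp add: map_upd_comp_transpose \<Gamma> domIff)
qed

lemma ty_rename_LSub:
  assumes "{a, b} \<inter> (fv M - {x}) = {}" "\<Gamma> \<turnstile>\<^sub>t LSub M N x \<Colon> \<tau>"
  shows "\<Gamma> \<turnstile>\<^sub>t LSub (swap a b M) N (transpose a b x) \<Colon> \<tau>"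
proof -
  from assms(2) obtain \<Gamma>' \<Delta> \<sigma> where *: "\<Gamma> = \<Gamma>' ++ \<Delta>" "dom \<Gamma>' \<inter> dom \<Delta> = {}" "x \<notin> dom \<Gamma>'"
    "\<Gamma>'(x \<mapsto> Strict \<sigma>) \<turnstile>\<^sub>t M \<Colon> \<tau>" "\<Delta> \<turnstile>\<^sub>t N \<Colon> \<sigma>"
    unfolding ty_LSub_iff by blast
  \<comment> \<open>\<open>N\<close> lies outside the scope of \<open>x\<close>, so only the part
    \<open>\<Gamma>'\<close> of the context has to be fixed by the swap.\<close>
  have "dom \<Gamma>' = fv M - {x}" using dom_eq_fv(1)[OF *(4)] *(3) by auto
  then have \<Gamma>': "\<Gamma>' \<circ> transpose a b = \<Gamma>'" using assms(1) by (intro fresh_comp_transpose) simp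
  then have "\<Gamma>' (transpose a b x) = \<Gamma>' x" by (metis comp_apply)
  with *(3) have "transpose a b x \<notin> dom \<Gamma>'" by (simp add: domIff)
  moreover have "\<Gamma>'(transpose a b x \<mapsto> Strict \<sigma>) \<turnstile>\<^sub>t swap a b M \<Colon> \<tau>"
    using ty_swap(1)[OF *(4), of a b] by (simp only: map_upd_comp_transpose \<Gamma>')
  ultimately show ?thesis using *(1,2,5) unfolding ty_LSub_iff by blast
qed

section \<open>Renaming as an equivalence: the converses apply the same lemmas to the swapped
  term\<close>

lemma ty_rename_Share_iff:
  assumes "{a, b} \<inter> (fv M - set xs) = {}"
  shows "\<Gamma> \<turnstile>\<^sub>t Share M xs x \<Colon> \<tau> \<longleftrightarrow>
    \<Gamma> \<turnstile>\<^sub>t Share (swap a b M) (map (transpose a b) xs) x \<Colon> \<tau>" (is "?L \<longleftrightarrow> ?R")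
proof
  show "?L \<Longrightarrow> ?R" by (rule ty_rename_Share[OF assms])
  assume R: ?R
  have "{a, b} \<inter> (fv (swap a b M) - set (map (transpose a b) xs)) = {}"
    using fresh_swap[OF assms] by simp
  from ty_rename_Share[OF this R] show ?L by (simp add: comp_def)
qed

text \<open>The freshness of the bound name belongs to each side, so that the equivalence rewrites
  the right-hand sides of \<open>ty_Abs_iff\<close> and \<open>ty_ESub_iff\<close>.\<close>

lemma ty_rename_Share_bound_iff:
  assumes "{a, b} \<inter> (fv (Share M xs x) - {x}) = {}"
  shows "x \<notin> dom \<Gamma> \<and> \<Gamma>(x \<mapsto> v) \<turnstile>\<^sub>t Share M xs x \<Colon> \<tau> \<longleftrightarrow>
    transpose a b x \<notin> dom \<Gamma> \<and> \<Gamma>(transpose a b x \<mapsto> v)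
      \<turnstile>\<^sub>t Share (swap a b M) (map (transpose a b) xs) (transpose a b x) \<Colon> \<tau>" (is "?L \<longleftrightarrow> ?R")
proof
  show "?L \<Longrightarrow> ?R" by (intro ty_rename_Share_bound[OF assms]) auto
  assume R: ?R
  have "{a, b} \<inter> (fv (Share (swap a b M) (map (transpose a b) xs) (transpose a b x)) -
      {transpose a b x}) = {}"
    using fresh_swap[OF assms] by (simp only: tm.map image_insert image_empty)
  from ty_rename_Share_bound[OF this R[THEN conjunct1] R[THEN conjunct2]] show ?L
    by (simp del: fun_upd_apply)
qed

lemma ty_rename_LSub_iff:
  assumes "{a, b} \<inter> (fv M - {x}) = {}"
  shows "\<Gamma> \<turnstile>\<^sub>t LSub M N x \<Colon> \<tau> \<longleftrightarrow> \<Gamma> \<turnstile>\<^sub>t LSub (swap a b M) N (transpose a b x) \<Colon> \<tau>"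
    (is "?L \<longleftrightarrow> ?R")
proof
  show "?L \<Longrightarrow> ?R" by (rule ty_rename_LSub[OF assms])
  assume R: ?R
  have "{a, b} \<inter> (fv (swap a b M) - {transpose a b x}) = {}"
    using fresh_swap[OF assms] by simp
  from ty_rename_LSub[OF this R] show ?L by simp
qed

text \<open>As an equivalence the claim is immediate for \<open>sym\<close>. The context is
  arbitrary because congruence passes under binders.\<close>

lemma alpha_ty: "M =\<^sub>\<alpha> M' \<Longrightarrow> \<Gamma> \<turnstile>\<^sub>t M \<Colon> \<tau> \<longleftrightarrow> \<Gamma> \<turnstile>\<^sub>t M' \<Colon> \<tau>"
proof (induction arbitrary: \<Gamma> \<tau> rule: alpha.induct)
  case (rename_LSub a b M x N)
  then show ?case by (rule ty_rename_LSub_iff)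
next
  case (rename_Share a b M xs x)
  then show ?case by (rule ty_rename_Share_iff)
next
  case (rename_Abs_shared a b M xs x)
  show ?case by (simp only: ty_Abs_iff ty_rename_Share_iff[OF rename_Abs_shared])
next
  case (rename_ESub_shared a b M xs x B)
  show ?case by (simp only: ty_ESub_iff ty_rename_Share_iff[OF rename_ESub_shared])
next
  case (rename_Abs a b M xs x)
  show ?case by (simp only: ty_Abs_iff ty_rename_Share_bound_iff[OF rename_Abs])
next
  case (rename_ESub a b M xs x B)
  show ?case by (simp only: ty_ESub_iff ty_rename_Share_bound_iff[OF rename_ESub])
\<comment> \<open>In the congruence cases the generation lemmas expose the typing of the changed
  subterm on both sides; \<open>ty_bag_add_mset_iff\<close> singles out the changed member of a
  bag.\<close>
qed (simp_all only: ty_Abs_iff ty_App_iff ty_LSub_iff ty_Share_iff ty_ESub_iff ty_bag_add_mset_iff)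

section \<open>Substitution\<close>

text \<open>No binder on the path to the head is \<open>x\<close>. This places \<open>x\<close> in
  the part of a split context that types the head side.\<close>

lemma lhsubst_fv: "lhsubst N x M M' \<Longrightarrow> x \<in> fv M"
  by (induction rule: lhsubst.induct) auto

text \<open>Induction along the path to the head. Disjointness exempts \<open>x\<close>, which may
  be free in \<open>N\<close>; therefore \<open>x\<close> is erased from \<open>\<Gamma>\<close>
  before \<open>\<Delta>\<close> is added.\<close>

lemma ty_lhsubst:
  assumes "lhsubst N x M M'" "\<Gamma> \<turnstile>\<^sub>t M \<Colon> \<tau>" "\<Gamma> x = Some (Strict \<sigma>)" "\<Delta> \<turnstile>\<^sub>t N \<Colon> \<sigma>"
    and "(dom \<Gamma> - {x}) \<inter> dom \<Delta> = {}"
  shows "\<Gamma>(x := None) ++ \<Delta> \<turnstile>\<^sub>t M' \<Colon> \<tau>"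
  using assms(1-3,5)
proof (induction arbitrary: \<Gamma> \<tau> rule: lhsubst.induct)
  case Var
  \<comment> \<open>A variable is typed in a singleton context, so erasing \<open>x\<close> leaves
    exactly \<open>\<Delta>\<close>.\<close>
  then have "\<Gamma>(x := None) = Map.empty" "\<sigma> = \<tau>" by (auto simp: ty_Var_iff)
  then show ?case using assms(4) by simp
next
  case (App M M' B)
  from App.prems(1) obtain \<Gamma>1 \<Gamma>2 \<pi> where *: "\<Gamma> = \<Gamma>1 ++ \<Gamma>2" "dom \<Gamma>1 \<inter> dom \<Gamma>2 = {}"
    "\<Gamma>1 \<turnstile>\<^sub>t M \<Colon> Arr \<pi> \<tau>" "\<Gamma>2 \<turnstile>\<^sub>b B \<Colon> \<pi>"
    unfolding ty_App_iff by blast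
  \<comment> \<open>Linearity: \<open>x\<close> is used on the head side, hence not by the bag,
    which can stay unchanged.\<close>
  have "x \<in> dom \<Gamma>1" using lhsubst_fv[OF App.hyps] dom_eq_fv(1)[OF *(3)] by simp
  then have x: "\<Gamma>2 x = None" using *(2) by auto
  with App.prems(2) have x1: "\<Gamma>1 x = Some (Strict \<sigma>)" by (simp add: *(1) map_add_def)
  have "(dom \<Gamma>1 - {x}) \<inter> dom \<Delta> = {}" using App.prems(3) *(1) by auto
  then have "\<Gamma>1(x := None) ++ \<Delta> \<turnstile>\<^sub>t M' \<Colon> Arr \<pi> \<tau>" by (intro App.IH[OF *(3) x1])
  moreover have disj: "dom (\<Gamma>1(x := None) ++ \<Delta>) \<inter> dom \<Gamma>2 = {}"
    using App.prems(3) * x by auto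
  moreover have "\<Gamma>(x := None) ++ \<Delta> = (\<Gamma>1(x := None) ++ \<Delta>) ++ \<Gamma>2"
    unfolding *(1) using disj x by (intro map_add_remove_swap) auto
  ultimately show ?case using *(4) unfolding ty_App_iff by blast
next
  case (LSub M M' y L)
  from LSub.prems(1) obtain \<Gamma>1 \<Gamma>2 \<rho> where *: "\<Gamma> = \<Gamma>1 ++ \<Gamma>2" "dom \<Gamma>1 \<inter> dom \<Gamma>2 = {}"
    "y \<notin> dom \<Gamma>1" "\<Gamma>1(y \<mapsto> Strict \<rho>) \<turnstile>\<^sub>t M \<Colon> \<tau>" "\<Gamma>2 \<turnstile>\<^sub>t L \<Colon> \<rho>"
    unfolding ty_LSub_iff by blast
  \<comment> \<open>The capture condition, read through \<open>dom_eq_fv\<close>, lets the update at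
    the bound \<open>y\<close> commute with the addition of \<open>\<Delta>\<close>.\<close>
  have y: "y \<notin> dom \<Delta>" using LSub.hyps(3) dom_eq_fv(1)[OF assms(4)] by simp
  have "x \<in> dom \<Gamma>1" using lhsubst_fv[OF LSub.hyps(1)] dom_eq_fv(1)[OF *(4)] LSub.hyps(2) by auto
  then have x: "\<Gamma>2 x = None" using *(2) by auto
  with LSub.prems(2) LSub.hyps(2) have x1: "(\<Gamma>1(y \<mapsto> Strict \<rho>)) x = Some (Strict \<sigma>)"
    by (simp add: *(1) map_add_def)
  have "(dom (\<Gamma>1(y \<mapsto> Strict \<rho>)) - {x}) \<inter> dom \<Delta> = {}" using LSub.prems(3) *(1) y by (auto simp del: fun_upd_apply)
  then have "(\<Gamma>1(y \<mapsto> Strict \<rho>))(x := None) ++ \<Delta> \<turnstile>\<^sub>t M' \<Colon> \<tau>" by (rule LSub.IH[OF *(4) x1])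
  moreover have "(\<Gamma>1(y \<mapsto> Strict \<rho>))(x := None) ++ \<Delta> = (\<Gamma>1(x := None) ++ \<Delta>)(y \<mapsto> Strict \<rho>)"
    using y LSub.hyps(2) by (auto simp: fun_eq_iff map_add_def split: option.splits)
  moreover have disj: "dom (\<Gamma>1(x := None) ++ \<Delta>) \<inter> dom \<Gamma>2 = {}"
    using LSub.prems(3) * x by auto
  moreover have "\<Gamma>(x := None) ++ \<Delta> = (\<Gamma>1(x := None) ++ \<Delta>) ++ \<Gamma>2"
    unfolding *(1) using disj x by (intro map_add_remove_swap) auto
  moreover have "y \<notin> dom (\<Gamma>1(x := None) ++ \<Delta>)" using y *(3) by auto
  ultimately show ?case using *(5) unfolding ty_LSub_iff by metis
next
  case (Share M M' y ys)
  from Share.prems(1) obtain \<Gamma>1 \<rho> where *: "\<Gamma> = \<Gamma>1(y \<mapsto> Multi (replicate_mset (length ys) \<rho>))"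
    "y \<notin> dom \<Gamma>1" "distinct ys" "set ys \<inter> dom \<Gamma>1 = {}"
    and M: "\<Gamma>1(ys [\<mapsto>] replicate (length ys) (Strict \<rho>)) \<turnstile>\<^sub>t M \<Colon> \<tau>" (is "?\<Gamma>2 \<turnstile>\<^sub>t _ \<Colon> _")
    unfolding ty_Share_iff by blast
  have ys: "x \<notin> set ys" "set ys \<inter> dom \<Delta> = {}"
    using Share.hyps(3) dom_eq_fv(1)[OF assms(4)] by auto
  \<comment> \<open>Here \<open>y\<close> remains free and lies in \<open>dom \<Gamma>\<close>, so
    it is separated from \<open>\<Delta>\<close> by disjointness; for \<open>ys\<close> the capture
    condition does this.\<close>
  have y: "y \<notin> dom \<Delta>" using Share.prems(3) Share.hyps(2) *(1) by auto
  have "?\<Gamma>2 x = Some (Strict \<sigma>)"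
    using Share.prems(2) ys(1) Share.hyps(2) by (simp add: *(1) map_upds_replicate)
  moreover have "(dom ?\<Gamma>2 - {x}) \<inter> dom \<Delta> = {}"
    using Share.prems(3) ys(2) *(1) by (auto simp del: fun_upd_apply)
  ultimately have "?\<Gamma>2(x := None) ++ \<Delta> \<turnstile>\<^sub>t M' \<Colon> \<tau>" by (rule Share.IH[OF M])
  moreover have "?\<Gamma>2(x := None) ++ \<Delta> =
      (\<Gamma>1(x := None) ++ \<Delta>)(ys [\<mapsto>] replicate (length ys) (Strict \<rho>))"
    using ys by (auto simp: fun_eq_iff map_upds_replicate map_add_def split: option.splits)
  moreover have "\<Gamma>(x := None) ++ \<Delta> =
      (\<Gamma>1(x := None) ++ \<Delta>)(y \<mapsto> Multi (replicate_mset (length ys) \<rho>))"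
    using y Share.hyps(2) by (auto simp: *(1) fun_eq_iff map_add_def split: option.splits)
  moreover have "y \<notin> dom (\<Gamma>1(x := None) ++ \<Delta>)" "set ys \<inter> dom (\<Gamma>1(x := None) ++ \<Delta>) = {}"
    using y ys *(2,4) by auto
  ultimately show ?case using *(3) unfolding ty_Share_iff by metis
next
  case (ESub M M' y ys B)
  from ESub.prems(1) obtain \<Gamma>1 \<Gamma>2 k \<rho>' where *: "\<Gamma> = \<Gamma>1 ++ \<Gamma>2" "dom \<Gamma>1 \<inter> dom \<Gamma>2 = {}"
    "y \<notin> dom \<Gamma>1" "\<Gamma>1(y \<mapsto> Multi (replicate_mset k \<rho>')) \<turnstile>\<^sub>t Share M ys y \<Colon> \<tau>"
    "\<Gamma>2 \<turnstile>\<^sub>b B \<Colon> replicate_mset k \<rho>'"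
    unfolding ty_ESub_iff by blast
  \<comment> \<open>For empty \<open>ys\<close> both powers are \<omega> and their bases are
    unrelated, so only the equation between the powers is kept.\<close>
  from *(4) obtain \<rho> where S: "replicate_mset k \<rho>' = replicate_mset (length ys) \<rho>"
    "distinct ys" "set ys \<inter> dom \<Gamma>1 = {}"
    and M: "\<Gamma>1(ys [\<mapsto>] replicate (length ys) (Strict \<rho>)) \<turnstile>\<^sub>t M \<Colon> \<tau>" (is "?\<Gamma>3 \<turnstile>\<^sub>t _ \<Colon> _")
    unfolding ty_Share_upd_iff[OF *(3)] by blast
  have ys: "x \<notin> set ys" "set ys \<inter> dom \<Delta> = {}" and y: "y \<notin> dom \<Delta>"
    using ESub.hyps(3,4) dom_eq_fv(1)[OF assms(4)] by auto
  have "x \<in> dom \<Gamma>1" using lhsubst_fv[OF ESub.hyps(1)] dom_eq_fv(1)[OF M] ys(1) by auto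
  then have x: "\<Gamma>2 x = None" using *(2) by auto
  with ESub.prems(2) ys(1) have "?\<Gamma>3 x = Some (Strict \<sigma>)"
    by (simp add: *(1) map_add_def map_upds_replicate)
  moreover have "(dom ?\<Gamma>3 - {x}) \<inter> dom \<Delta> = {}" using ESub.prems(3) ys(2) *(1) by auto
  ultimately have "?\<Gamma>3(x := None) ++ \<Delta> \<turnstile>\<^sub>t M' \<Colon> \<tau>" by (rule ESub.IH[OF M])
  also have "?\<Gamma>3(x := None) ++ \<Delta> =
      (\<Gamma>1(x := None) ++ \<Delta>)(ys [\<mapsto>] replicate (length ys) (Strict \<rho>))"
    using ys by (auto simp: fun_eq_iff map_upds_replicate map_add_def split: option.splits)
  finally have M': "(\<Gamma>1(x := None) ++ \<Delta>)(ys [\<mapsto>] replicate (length ys) (Strict \<rho>)) \<turnstile>\<^sub>t M' \<Colon> \<tau>" .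
  have y1: "y \<notin> dom (\<Gamma>1(x := None) ++ \<Delta>)" and "set ys \<inter> dom (\<Gamma>1(x := None) ++ \<Delta>) = {}"
    using y ys *(3) S(3) by auto
  with S(1,2) M'
  have "(\<Gamma>1(x := None) ++ \<Delta>)(y \<mapsto> Multi (replicate_mset k \<rho>')) \<turnstile>\<^sub>t Share M' ys y \<Colon> \<tau>"
    unfolding ty_Share_upd_iff[OF y1] by blast
  moreover have disj: "dom (\<Gamma>1(x := None) ++ \<Delta>) \<inter> dom \<Gamma>2 = {}"
    using ESub.prems(3) * x by auto
  moreover have "\<Gamma>(x := None) ++ \<Delta> = (\<Gamma>1(x := None) ++ \<Delta>) ++ \<Gamma>2"
    unfolding *(1) using disj x by (intro map_add_remove_swap) auto
  ultimately show ?case using *(5) y1 unfolding ty_ESub_iff by (intro exI conjI) (assumption+)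
qed

text \<open>Each linear substitution moves the context of one bag member into
  \<open>\<Gamma>\<close>. Since the shared names are not free in the members, the names still to be
  substituted do not clash with that context.\<close>

lemma ty_lsubs:
  assumes "\<Delta> \<turnstile>\<^sub>b mset Ns \<Colon> replicate_mset k \<sigma>" "length xs = length Ns" "distinct xs"
    and "set xs \<inter> dom \<Gamma> = {}" "dom \<Gamma> \<inter> dom \<Delta> = {}" "\<forall>N \<in> set Ns. set xs \<inter> fv N = {}"
    and "\<Gamma>(xs [\<mapsto>] replicate (length xs) (Strict \<sigma>)) \<turnstile>\<^sub>t M \<Colon> \<tau>"
  shows "\<Gamma> ++ \<Delta> \<turnstile>\<^sub>t lsubs M Ns xs \<Colon> \<tau>"
  using assms
proof (induction Ns arbitrary: \<Gamma> \<Delta> M k xs)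
  case Nil
  from Nil.prems(1) have "\<Delta> = Map.empty" using dom_eq_fv(2) by fastforce
  with Nil show ?case by (simp add: lsubs_def)
next
  case (Cons N Ns)
  then obtain x xs' where xs: "xs = x # xs'" by (cases xs) auto
  from Cons.prems(1) obtain \<Delta>1 \<Delta>2 j where *: "\<Delta> = \<Delta>1 ++ \<Delta>2" "dom \<Delta>1 \<inter> dom \<Delta>2 = {}"
    "\<Delta>1 \<turnstile>\<^sub>t N \<Colon> \<sigma>" "\<Delta>2 \<turnstile>\<^sub>b mset Ns \<Colon> replicate_mset j \<sigma>"
    by (auto simp: ty_bag_add_mset_iff replicate_mset_eq_Suc simp del: replicate_mset_Suc)
  have N: "set xs \<inter> dom \<Delta>1 = {}" using Cons.prems(6) dom_eq_fv(1)[OF *(3)] by simp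
  let ?\<Gamma>' = "\<Gamma>(xs' [\<mapsto>] replicate (length xs') (Strict \<sigma>))"
  \<comment> \<open>The update at \<open>x\<close> is moved outermost, as \<open>ex_lin_sub\<close>
    expects it.\<close>
  have "\<Gamma>(xs [\<mapsto>] replicate (length xs) (Strict \<sigma>)) = ?\<Gamma>'(x \<mapsto> Strict \<sigma>)"
    by (auto simp: xs map_upds_replicate fun_eq_iff)
  with Cons.prems(7) have "?\<Gamma>'(x \<mapsto> Strict \<sigma>) \<turnstile>\<^sub>t M \<Colon> \<tau>" by (simp only:)
  moreover have "x \<notin> dom ?\<Gamma>'" using Cons.prems(3,4) by (auto simp: xs)
  moreover have "dom ?\<Gamma>' \<inter> dom \<Delta>1 = {}" using Cons.prems(5) N by (auto simp: xs *(1))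
  ultimately have "?\<Gamma>' ++ \<Delta>1 \<turnstile>\<^sub>t LSub M N x \<Colon> \<tau>" by (intro ex_lin_sub[OF *(3)])
  \<comment> \<open>This gives the context the form of the induction hypothesis, with
    \<open>\<Gamma> ++ \<Delta>1\<close> in place of \<open>\<Gamma>\<close>.\<close>
  moreover have "?\<Gamma>' ++ \<Delta>1 = (\<Gamma> ++ \<Delta>1)(xs' [\<mapsto>] replicate (length xs') (Strict \<sigma>))"
    using N by (auto simp: xs map_upds_replicate map_add_def fun_eq_iff split: option.splits)
  moreover have "set xs' \<inter> dom (\<Gamma> ++ \<Delta>1) = {}" "dom (\<Gamma> ++ \<Delta>1) \<inter> dom \<Delta>2 = {}"
    using Cons.prems(4,5) N *(1,2) by (auto simp: xs)
  ultimately have "(\<Gamma> ++ \<Delta>1) ++ \<Delta>2 \<turnstile>\<^sub>t lsubs (LSub M N x) Ns xs' \<Colon> \<tau>"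
    using Cons.prems by (intro Cons.IH[OF *(4)]) (auto simp: xs)
  then show ?case by (simp add: xs lsubs_def *(1))
qed

section \<open>Subject reduction\<close>

text \<open>The rule \<open>sum\<close> may group summands in any way; this form is independent of
  the grouping. Nonemptiness appears because the empty sum has no type.\<close>

lemma ty_expr_iff: "\<Gamma> \<turnstile> E \<Colon> \<tau> \<longleftrightarrow> E \<noteq> {#} \<and> (\<forall>M \<in># E. \<Gamma> \<turnstile>\<^sub>t M \<Colon> \<tau>)"
proof
  show "\<Gamma> \<turnstile> E \<Colon> \<tau> \<Longrightarrow> E \<noteq> {#} \<and> (\<forall>M \<in># E. \<Gamma> \<turnstile>\<^sub>t M \<Colon> \<tau>)"
    by (induction rule: ty_expr.induct) auto
  have "E \<noteq> {#} \<Longrightarrow> \<forall>M \<in># E. \<Gamma> \<turnstile>\<^sub>t M \<Colon> \<tau> \<Longrightarrow> \<Gamma> \<turnstile> E \<Colon> \<tau>"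
  proof (induction E)
    case (add M E)
    then show ?case
      using tm sum[of \<Gamma> "{#M#}" \<tau> E] by (cases "E = {#}") auto
  qed simp
  then show "E \<noteq> {#} \<and> (\<forall>M \<in># E. \<Gamma> \<turnstile>\<^sub>t M \<Colon> \<tau>) \<Longrightarrow> \<Gamma> \<turnstile> E \<Colon> \<tau>" by blast
qed

lemma rel_mset_alpha_ty:
  assumes "rel_mset (=\<^sub>\<alpha>) E F"
  shows "\<Gamma> \<turnstile> E \<Colon> \<tau> \<longleftrightarrow> \<Gamma> \<turnstile> F \<Colon> \<tau>"
proof -
  from assms obtain Ms Ns where "mset Ms = E" "mset Ns = F" "list_all2 (=\<^sub>\<alpha>) Ms Ns"
    by (auto simp: rel_mset_def)
  from this(3) have "(\<forall>M \<in> set Ms. \<Gamma> \<turnstile>\<^sub>t M \<Colon> \<tau>) \<longleftrightarrow> (\<forall>N \<in> set Ns. \<Gamma> \<turnstile>\<^sub>t N \<Colon> \<tau>)"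
  proof (induction rule: list_all2_induct)
    case (Cons M Ms N Ns)
    with alpha_ty[OF Cons.hyps(1), of \<Gamma> \<tau>] show ?case by simp
  qed simp
  moreover have "Ms = [] \<longleftrightarrow> Ns = []" using \<open>list_all2 (=\<^sub>\<alpha>) Ms Ns\<close> by auto
  ultimately show ?thesis
    using \<open>mset Ms = E\<close> \<open>mset Ns = F\<close> by (auto simp: ty_expr_iff)
qed

text \<open>A nonempty target keeps sums under a term context typable; a nonempty source lets the
  reduced part of a sum be typed on its own.\<close>

lemma red_nonempty: "E \<leadsto> E' \<Longrightarrow> E \<noteq> {#} \<and> E' \<noteq> {#}"
  by (induction rule: red.induct) (auto simp: mset_set_empty_iff dest: rel_mset_size)

text \<open>The assumption ranges over all contexts and types because those of the hole differ from
  those of the whole term.\<close>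

lemma ty_tm_context:
  assumes "\<And>\<Gamma> \<tau>. \<Gamma> \<turnstile>\<^sub>t M \<Colon> \<tau> \<Longrightarrow> \<Gamma> \<turnstile>\<^sub>t M' \<Colon> \<tau>"
  shows "\<Gamma> \<turnstile>\<^sub>t App M B \<Colon> \<tau> \<Longrightarrow> \<Gamma> \<turnstile>\<^sub>t App M' B \<Colon> \<tau>"
    and "\<Gamma> \<turnstile>\<^sub>t LSub M N x \<Colon> \<tau> \<Longrightarrow> \<Gamma> \<turnstile>\<^sub>t LSub M' N x \<Colon> \<tau>"
    and "\<Gamma> \<turnstile>\<^sub>t Share M xs x \<Colon> \<tau> \<Longrightarrow> \<Gamma> \<turnstile>\<^sub>t Share M' xs x \<Colon> \<tau>"
    and "\<Gamma> \<turnstile>\<^sub>t ESub M xs x B \<Colon> \<tau> \<Longrightarrow> \<Gamma> \<turnstile>\<^sub>t ESub M' xs x B \<Colon> \<tau>"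
proof -
  show "\<Gamma> \<turnstile>\<^sub>t App M B \<Colon> \<tau> \<Longrightarrow> \<Gamma> \<turnstile>\<^sub>t App M' B \<Colon> \<tau>"
    unfolding ty_App_iff using assms by blast
  show "\<Gamma> \<turnstile>\<^sub>t LSub M N x \<Colon> \<tau> \<Longrightarrow> \<Gamma> \<turnstile>\<^sub>t LSub M' N x \<Colon> \<tau>"
    unfolding ty_LSub_iff using assms by blast
  have Share: "\<Gamma> \<turnstile>\<^sub>t Share M xs x \<Colon> \<tau> \<Longrightarrow> \<Gamma> \<turnstile>\<^sub>t Share M' xs x \<Colon> \<tau>" for \<Gamma> \<tau>
    unfolding ty_Share_iff using assms by blast
  show "\<Gamma> \<turnstile>\<^sub>t Share M xs x \<Colon> \<tau> \<Longrightarrow> \<Gamma> \<turnstile>\<^sub>t Share M' xs x \<Colon> \<tau>" by (rule Share)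
  show "\<Gamma> \<turnstile>\<^sub>t ESub M xs x B \<Colon> \<tau> \<Longrightarrow> \<Gamma> \<turnstile>\<^sub>t ESub M' xs x B \<Colon> \<tau>"
    unfolding ty_ESub_iff using Share by blast
qed

text \<open>The rules \<open>abs_sh\<close> and \<open>ex_sub\<close> have the same premise about
  the sharing term, so the parts of the redex derivation are merely reassembled.\<close>

lemma ty_Beta:
  assumes "\<Gamma> \<turnstile>\<^sub>t App (Abs x xs M) B \<Colon> \<tau>"
  shows "\<Gamma> \<turnstile>\<^sub>t ESub M xs x B \<Colon> \<tau>"
  using assms unfolding ty_App_iff ty_Abs_iff ty_ESub_iff by blast

text \<open>All members of a typable bag have one common strict type, so each ordering
  \<open>Ns\<close> may be matched with the shared names.\<close>

lemma ty_Ex_Sub: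
  assumes "\<Gamma> \<turnstile>\<^sub>t ESub M xs x (mset Ns) \<Colon> \<tau>" "length Ns = length xs" "xs \<noteq> []"
    and "\<forall>N \<in> set Ns. set xs \<inter> fv N = {}"
  shows "\<Gamma> \<turnstile>\<^sub>t lsubs M Ns xs \<Colon> \<tau>"
proof -
  from assms(1) obtain \<Gamma>1 \<Delta> k \<rho> where *: "\<Gamma> = \<Gamma>1 ++ \<Delta>" "dom \<Gamma>1 \<inter> dom \<Delta> = {}" "x \<notin> dom \<Gamma>1"
    "\<Gamma>1(x \<mapsto> Multi (replicate_mset k \<rho>)) \<turnstile>\<^sub>t Share M xs x \<Colon> \<tau>"
    "\<Delta> \<turnstile>\<^sub>b mset Ns \<Colon> replicate_mset k \<rho>"
    unfolding ty_ESub_iff by blast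
  from *(4) obtain \<sigma> where S: "replicate_mset k \<rho> = replicate_mset (length xs) \<sigma>"
    "distinct xs" "set xs \<inter> dom \<Gamma>1 = {}"
    "\<Gamma>1(xs [\<mapsto>] replicate (length xs) (Strict \<sigma>)) \<turnstile>\<^sub>t M \<Colon> \<tau>"
    unfolding ty_Share_upd_iff[OF *(3)] by blast
  show ?thesis
    unfolding *(1) using ty_lsubs[OF *(5)[unfolded S(1)] _ S(2,3) *(2) assms(4) S(4)] assms(2) by simp
qed

lemma ty_Lin_Fetch:
  assumes "lhsubst N x M M'" "\<Gamma> \<turnstile>\<^sub>t LSub M N x \<Colon> \<tau>"
  shows "\<Gamma> \<turnstile>\<^sub>t M' \<Colon> \<tau>"
proof -
  from assms(2) obtain \<Gamma>1 \<Delta> \<sigma> where *: "\<Gamma> = \<Gamma>1 ++ \<Delta>" "dom \<Gamma>1 \<inter> dom \<Delta> = {}" "x \<notin> dom \<Gamma>1"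
    "\<Gamma>1(x \<mapsto> Strict \<sigma>) \<turnstile>\<^sub>t M \<Colon> \<tau>" "\<Delta> \<turnstile>\<^sub>t N \<Colon> \<sigma>"
    unfolding ty_LSub_iff by blast
  \<comment> \<open>Since \<open>x\<close> is not in \<open>dom \<Gamma>1\<close>, erasing it undoes
    the extension, and \<open>ty_lhsubst\<close> yields the context
    \<open>\<Gamma>1 ++ \<Delta>\<close>.\<close>
  from *(3) have "(\<Gamma>1(x \<mapsto> Strict \<sigma>))(x := None) = \<Gamma>1" by (auto simp: fun_eq_iff)
  with ty_lhsubst[OF assms(1) *(4) _ *(5)] *(1,2) show ?thesis by auto
qed

theorem theorem3p13:
  fixes \<Gamma> :: ctx and E E' :: expr and \<tau> :: sty
  assumes "\<Gamma> \<turnstile> E \<Colon> \<tau>"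
    and "E \<leadsto> E'"
  shows "\<Gamma> \<turnstile> E' \<Colon> \<tau>"
  using assms(2,1)
proof (induction arbitrary: \<Gamma> \<tau> rule: red.induct)
  case (Beta x xs M B)
  then show ?case by (simp add: ty_expr_iff ty_Beta)
next
  case (Ex_Sub B xs M x)
  \<comment> \<open>The summands of the reduct are given by the lists \<open>Ns\<close> with
    multiset \<open>B\<close>, so one statement for all such lists covers the sum.\<close>
  have "\<Gamma> \<turnstile>\<^sub>t lsubs M Ns xs \<Colon> \<tau>" if "mset Ns = B" for Ns
    using ty_Ex_Sub[of \<Gamma> M xs x Ns \<tau>] Ex_Sub that
    by (cases xs) (auto simp: ty_expr_iff)
  moreover have "permutations_of_multiset B \<noteq> {}" by simp
  ultimately show ?case
    by (auto simp: ty_expr_iff mset_set_empty_iff permutations_of_multisetD)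
next
  case (Lin_Fetch M x N M')
  then show ?case by (auto simp: ty_expr_iff intro: ty_Lin_Fetch)
next
  case (TCont_App M E B)
  then show ?case
    \<comment> \<open>By induction every summand of \<open>E\<close> has all typings of
      \<open>M\<close>, so the context lemma applies to each summand separately.\<close>
    using red_nonempty[OF TCont_App.hyps] ty_tm_context(1)[of M] by (simp add: ty_expr_iff)
next
  case (TCont_LSub M E N x)
  then show ?case
    using red_nonempty[OF TCont_LSub.hyps] ty_tm_context(2)[of M] by (simp add: ty_expr_iff)
next
  case (TCont_Share M E xs x)
  then show ?case
    using red_nonempty[OF TCont_Share.hyps] ty_tm_context(3)[of M] by (simp add: ty_expr_iff)
next
  case (TCont_ESub M E xs x B)
  then show ?case
    using red_nonempty[OF TCont_ESub.hyps] ty_tm_context(4)[of M] by (simp add: ty_expr_iff)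
next
  case (ECont E E' F)
  then show ?case using red_nonempty[of E E'] by (auto simp: ty_expr_iff)
next
  case (alpha E E1 E2 E')
  \<comment> \<open>The typing passes from \<open>E\<close> to \<open>E1\<close>, by induction to
    \<open>E2\<close>, and from there to \<open>E'\<close>.\<close>
  then show ?case using rel_mset_alpha_ty by blast
qed

end
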